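(* Let $n$ and $r$ be integers with $2\le r\le n-2$. Then the Johnson graph $J(n,r)$ is strongly $2$-monophonic.
   Context: The Johnson graph $J(n,r)$ has as vertices all $r$-element subsets of $[n]=\{1,\dots,n\}$, two vertices $A,B$ being adjacent iff $|A\cap B|=r-1$. For a graph $G$ and $u,v\in V(G)$, the monophonic interval $J_G(u,v)$ is the set of all vertices lying on some induced $u,v$-path in $G$, with the convention $u,v\in J_G(u,v)$. A set $S\subseteq V(G)$ is monophonic if for every $w\in V(G)$ there exist $x,y\in S$ with $w\in J_G(x,y)$; $m(G)$ is the minimum size of a monophonic set. $G$ is $2$-monophonic if $m(G)=2$, and strongly $2$-monophonic if it is $2$-monophonic and $\{x,y\}$ is a monophonic set for every pair of non-adjacent vertices $x,y$. *)

theory Defs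
  imports "Graph_Theory.Graph_Theory"
begin

text \<open>A simple graph is a symmetric loop-free digraph: each edge is represented by its two
  opposite arcs.\<close>

definition johnson_graph :: "nat \<Rightarrow> nat \<Rightarrow> (nat set, nat set \<times> nat set) pre_digraph" where
  "johnson_graph n r = with_proj
     \<lparr> pverts = {A. A \<subseteq> {1..n} \<and> card A = r},
       parcs = {(A, B). A \<subseteq> {1..n} \<and> card A = r \<and> B \<subseteq> {1..n} \<and> card B = r
                        \<and> card (A \<inter> B) + 1 = r} \<rparr>"

lemma graph_johnson_graph: "graph (johnson_graph n r)"
proof -
  let ?G = "\<lparr> pverts = {A. A \<subseteq> {1..n} \<and> card A = r},
       parcs = {(A, B). A \<subseteq> {1..n} \<and> card A = r \<and> B \<subseteq> {1..n} \<and> card B = r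
                        \<and> card (A \<inter> B) + 1 = r} \<rparr>"
  have V: "finite (pverts ?G)"
    by (rule finite_subset[of _ "Pow {1..n}"]) (simp_all add: Collect_mono_iff Pow_def)
  have "parcs ?G \<subseteq> Pow {1..n} \<times> Pow {1..n}"
    unfolding pair_pre_digraph.simps by blast
  then have E: "finite (parcs ?G)"
    by (rule finite_subset) simp
  have sym: "symmetric (with_proj ?G)"
    unfolding symmetric_def sym_def with_proj_simps pair_pre_digraph.simps
    by (simp only: mem_Collect_eq case_prod_conv Int_commute) blast
  have wf: "fst e \<in> pverts ?G" "snd e \<in> pverts ?G" if "e \<in> parcs ?G" for e
    using that unfolding pair_pre_digraph.simps by fastforce+
  have loop: "fst e \<noteq> snd e" if "e \<in> parcs ?G" for e
  proof
    assume eq: "fst e = snd e"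
    have "card (fst e) = r" "card (fst e \<inter> snd e) + 1 = r"
      using that unfolding pair_pre_digraph.simps mem_Collect_eq case_prod_beta by blast+
    then show False unfolding eq Int_absorb by linarith
  qed
  have "pair_graph ?G"
    by (intro pair_graph.intro pair_digraph.intro pair_fin_digraph.intro pair_wf_digraph.intro
        pair_loopfree_digraph.intro pair_pseudo_graph.intro pair_sym_digraph.intro
        pair_fin_digraph_axioms.intro pair_loopfree_digraph_axioms.intro
        pair_sym_digraph_axioms.intro wf loop V E sym)
  then have "graph (with_proj ?G)"
    by (rule pair_graph.pair_graphD_graph)
  then show ?thesis unfolding johnson_graph_def .
qed

text \<open>A path is induced if the subgraph induced by its vertices has no edges other than those of
  the path; the converse accounts for the opposite arcs.\<close>

definition induced_path :: "('a, 'b) pre_digraph \<Rightarrow> 'a \<Rightarrow> 'a list \<Rightarrow> 'a \<Rightarrow> bool" where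
  "induced_path G u p v \<longleftrightarrow> vpath p G \<and> hd p = u \<and> last p = v \<and>
     arcs_ends (G \<restriction> set p) = set (vwalk_arcs p) \<union> (set (vwalk_arcs p))\<inverse>"

definition monophonic_interval :: "('a, 'b) pre_digraph \<Rightarrow> 'a \<Rightarrow> 'a \<Rightarrow> 'a set" where
  "monophonic_interval G u v = {u, v} \<union> {w. \<exists>p. induced_path G u p v \<and> w \<in> set p}"

definition monophonic_set :: "('a, 'b) pre_digraph \<Rightarrow> 'a set \<Rightarrow> bool" where
  "monophonic_set G S \<longleftrightarrow> S \<subseteq> verts G \<and>
     (\<forall>w \<in> verts G. \<exists>x \<in> S. \<exists>y \<in> S. w \<in> monophonic_interval G x y)"

text \<open>In a finite graph the minimum exists, as the whole vertex set is monophonic.\<close>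

definition monophonic_number :: "('a, 'b) pre_digraph \<Rightarrow> nat" where
  "monophonic_number G = (LEAST k. \<exists>S. monophonic_set G S \<and> finite S \<and> card S = k)"

definition two_monophonic :: "('a, 'b) pre_digraph \<Rightarrow> bool" where
  "two_monophonic G \<longleftrightarrow> monophonic_number G = 2"

definition strongly_two_monophonic :: "('a, 'b) pre_digraph \<Rightarrow> bool" where
  "strongly_two_monophonic G \<longleftrightarrow> two_monophonic G \<and>
     (\<forall>x \<in> verts G. \<forall>y \<in> verts G. x \<noteq> y \<and> (x, y) \<notin> arcs_ends G \<longrightarrow> monophonic_set G {x, y})"

end

theory Submission
  imports Defs
begin

text \<open>To join \<open>X\<close> to \<open>Y\<close> through \<open>W\<close>, concatenate a geodesic from \<open>X\<close> to \<open>W\<close> with one from \<open>W\<close>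
  to \<open>Y\<close>. Seen from \<open>W\<close>, a geodesic is a choice of orders in which the elements of \<open>W - X\<close> are
  exchanged for those of \<open>X - W\<close>, and only the first two exchanges matter: as
  \<open>card (X - Y) \<ge> 2\<close> and \<open>X - Y\<close> is the disjoint union of \<open>(W - Y) - (W - X)\<close> and
  \<open>(X - W) - (Y - W)\<close>, these can be chosen such that every inner vertex on the \<open>X\<close> side keeps
  two elements that the one on the \<open>Y\<close> side lacks.\<close>

section \<open>Induced paths as indexed families of vertices\<close>

lemma arcs_ends_induce_subgraph: "arcs_ends (G \<restriction> S) = arcs_ends G \<inter> S \<times> S"
  by (auto simp: arcs_ends_conv)

lemma set_vwalk_arcs_map_upt:
  "set (vwalk_arcs (map f [0..<Suc n])) = {(f k, f (Suc k)) | k. k < n}"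
proof (induction n)
  case (Suc n)
  have "map f [0..<Suc (Suc n)] = map f [0..<Suc n] @ [f (Suc n)]" by simp
  moreover have "set (vwalk_arcs (map f [0..<Suc n] @ [f (Suc n)]))
      = insert (last (map f [0..<Suc n]), f (Suc n)) (set (vwalk_arcs (map f [0..<Suc n])))"
    by (rule set_vwalk_arcs_snoc) simp
  moreover have "last (map f [0..<Suc n]) = f n" by simp
  ultimately show ?case using Suc by (auto simp: less_Suc_eq simp del: upt_Suc)
qed simp

text \<open>Symmetry and irreflexivity of the arc relation leave only index pairs
  \<open>k < l\<close> to check: \<open>l = Suc k\<close> supplies the steps of the walk, all other
  pairs exclude chords.\<close>

lemma induced_path_map_upt:
  assumes "sym (arcs_ends G)" and "irrefl (arcs_ends G)"
    and verts: "\<And>k. k \<le> n \<Longrightarrow> f k \<in> verts G"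
    and neq: "\<And>k l. k < l \<Longrightarrow> l \<le> n \<Longrightarrow> f k \<noteq> f l"
    and adj: "\<And>k l. k < l \<Longrightarrow> l \<le> n \<Longrightarrow> (f k, f l) \<in> arcs_ends G \<longleftrightarrow> l = Suc k"
  shows "induced_path G (f 0) (map f [0..<Suc n]) (f n)"
proof -
  let ?p = "map f [0..<Suc n]" and ?E = "{(f k, f (Suc k)) | k. k < n}"
  have set: "set ?p = f ` {..n}" by (auto simp: image_iff le_less)
  have "inj_on f {0..<Suc n}"
    by (intro linorder_inj_onI) (auto dest: neq)
  then have "distinct ?p" by (simp only: distinct_map distinct_upt set_upt)
  moreover have "?E \<subseteq> arcs_ends G" using adj by auto
  ultimately have "vpath ?p G"
    using verts unfolding vpath_def vwalk_def set_vwalk_arcs_map_upt set by auto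
  moreover have "arcs_ends G \<inter> f ` {..n} \<times> f ` {..n} = ?E \<union> ?E\<inverse>"
  proof (intro equalityI subsetI)
    fix e assume "e \<in> arcs_ends G \<inter> f ` {..n} \<times> f ` {..n}"
    then obtain k l where e: "e = (f k, f l)" "(f k, f l) \<in> arcs_ends G" "k \<le> n" "l \<le> n"
      by auto
    then have "(f l, f k) \<in> arcs_ends G" "k \<noteq> l"
      using assms(1,2) by (auto dest: symD simp: irrefl_def)
    with e adj[of k l] adj[of l k] show "e \<in> ?E \<union> ?E\<inverse>"
      by (cases k l rule: linorder_cases) auto
  next
    fix e assume "e \<in> ?E \<union> ?E\<inverse>"
    then obtain k where k: "k < n" "e = (f k, f (Suc k)) \<or> e = (f (Suc k), f k)" by auto
    moreover from k have "(f k, f (Suc k)) \<in> arcs_ends G" using adj by auto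
    ultimately show "e \<in> arcs_ends G \<inter> f ` {..n} \<times> f ` {..n}"
      using assms(1) by (auto dest: symD)
  qed
  moreover have "hd ?p = f 0" by (simp add: hd_map del: upt_Suc)
  moreover have "last ?p = f n" by simp
  ultimately show ?thesis
    unfolding induced_path_def arcs_ends_induce_subgraph set_vwalk_arcs_map_upt set by simp
qed

section \<open>Cardinalities and enumerations of finite sets\<close>

lemma card_Diff_commute:
  assumes "finite A" and "finite B" and "card A = card B"
  shows "card (A - B) = card (B - A)"
  using assms by (metis card_Diff_subset_Int finite_Int Int_commute)

lemma two_le_card:
  assumes "finite A" and "x \<in> A" and "y \<in> A" and "x \<noteq> y"
  shows "2 \<le> card A"
  using card_mono[of A "{x, y}"] assms by auto

lemma two_le_cardE:
  assumes "2 \<le> card A"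
  obtains x y where "x \<in> A" and "y \<in> A" and "x \<noteq> y"
  using assms by (auto simp: numeral_2_eq_2 card_le_Suc_iff)

text \<open>Lets an order of exchange be prescribed at its beginning and left arbitrary
  afterwards.\<close>

lemma ex_distinct_list_prefix:
  assumes "finite S" and "set es \<subseteq> S" and "distinct es"
  obtains ys where "distinct (es @ ys)" and "set (es @ ys) = S"
proof -
  obtain ys where "set ys = S - set es" "distinct ys"
    using assms(1) by (meson finite_Diff finite_distinct_list)
  with assms that[of ys] show ?thesis by auto
qed

section \<open>Adjacency in the Johnson graph\<close>

lemma verts_johnson_graph: "verts (johnson_graph n r) = {A. A \<subseteq> {1..n} \<and> card A = r}"
  by (simp add: johnson_graph_def)

text \<open>\<open>A\<close> splits into \<open>A \<inter> B\<close> and \<open>A - B\<close>, so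
  sharing all but one element means losing exactly one. In this form adjacency can be read off from
  differences of exchange stages.\<close>

lemma arcs_ends_johnson_graph:
  "(A, B) \<in> arcs_ends (johnson_graph n r) \<longleftrightarrow>
     A \<in> verts (johnson_graph n r) \<and> B \<in> verts (johnson_graph n r) \<and> card (A - B) = 1"
proof -
  have "card (A - B) = 1 \<longleftrightarrow> card (A \<inter> B) + 1 = r" if "A \<subseteq> {1..n}" "card A = r"
  proof -
    have "finite A" using that finite_subset by blast
    then have "card A = card (A \<inter> B) + card (A - B)"
      by (metis card_Int_Diff)
    with that show ?thesis by linarith
  qed
  then show ?thesis by (auto simp: johnson_graph_def)
qed

lemma sym_arcs_ends_johnson_graph: "sym (arcs_ends (johnson_graph n r))"
proof -
  interpret graph "johnson_graph n r" by (rule graph_johnson_graph)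
  show ?thesis using sym_arcs by (simp add: symmetric_def)
qed

lemma irrefl_arcs_ends_johnson_graph: "irrefl (arcs_ends (johnson_graph n r))"
  by (auto simp: irrefl_def arcs_ends_johnson_graph)

section \<open>Geodesics as sequences of exchanges\<close>

text \<open>If \<open>as\<close> and \<open>cs\<close> enumerate \<open>W - X\<close> and
  \<open>X - W\<close> without repetition, these are the vertices of a geodesic from
  \<open>W\<close> to \<open>X\<close>; \<open>take\<close> keeps the sequence at \<open>X\<close>
  once the lists are used up.\<close>

definition exchange :: "'a set \<Rightarrow> 'a list \<Rightarrow> 'a list \<Rightarrow> nat \<Rightarrow> 'a set" where
  "exchange W as cs i = W - set (take i as) \<union> set (take i cs)"

lemma exchange_0 [simp]: "exchange W as cs 0 = W"
  by (simp add: exchange_def)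

lemma finite_exchange: "finite W \<Longrightarrow> finite (exchange W as cs i)"
  by (simp add: exchange_def)

text \<open>Once discarded on the \<open>bs\<close> side, \<open>b\<close> cannot return there,
  since \<open>ds\<close> only brings in elements outside \<open>W\<close>.\<close>

lemma kept_in_exchange_Diff:
  assumes "b \<in> W" and "b \<notin> set (take i as)" and "b \<in> set (take j bs)" and "set ds = Y - W"
  shows "b \<in> exchange W as cs i - exchange W bs ds j"
  using assms set_take_subset[of j ds] unfolding exchange_def by blast

lemma new_in_exchange_Diff:
  assumes "c \<notin> W" and "c \<in> set (take i cs)" and "c \<notin> set (take j ds)"
  shows "c \<in> exchange W as cs i - exchange W bs ds j"
  using assms unfolding exchange_def by blast

lemma notin_set_take: "x \<notin> set xs \<Longrightarrow> x \<notin> set (take k xs)"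
  by (auto dest: in_set_takeD)

lemma exchange_full:
  assumes "set as = W - X" and "set cs = X - W" and "length as = p" and "length cs = p"
  shows "exchange W as cs p = X"
  using assms by (auto simp: exchange_def)

locale exchange_lists =
  fixes W :: "'a set" and as cs :: "'a list" and p :: nat
  assumes fin: "finite W"
    and distinct: "distinct as" "distinct cs"
    and length: "length as = p" "length cs = p"
    and sub: "set as \<subseteq> W" and disj: "set cs \<inter> W = {}"
begin

lemma card_exchange:
  assumes "i \<le> p"
  shows "card (exchange W as cs i) = card W"
proof -
  have 1: "set (take i as) \<subseteq> W" "W \<inter> set (take i cs) = {}"
    using sub disj by (auto dest: in_set_takeD)
  have "card (set (take i as)) = i" "card (set (take i cs)) = i"
    using distinct length assms by (simp_all add: distinct_card)
  \<comment> \<open>Secures \<open>i \<le> card W\<close>, so that truncated subtraction in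
    \<open>card W - i + i\<close> loses nothing.\<close>
  moreover have "card (set (take i as)) \<le> card W"
    using 1 fin by (simp add: card_mono)
  moreover have "(W - set (take i as)) \<inter> set (take i cs) = {}" using 1 by auto
  ultimately show ?thesis
    unfolding exchange_def using 1 fin by (simp add: card_Un_disjoint card_Diff_subset)
qed

text \<open>Stage \<open>j\<close> still has every element inserted by stage \<open>i\<close>, so
  the difference is just the block of \<open>as\<close> discarded in between.\<close>

lemma card_exchange_Diff:
  assumes "i \<le> j" and "j \<le> p"
  shows "card (exchange W as cs i - exchange W as cs j) = j - i"
proof -
  have app: "take j as = take i as @ drop i (take j as)"
    by (metis append_take_drop_id assms(1) min.absorb1 take_take)
  have "distinct (take j as)" using distinct by simp
  then have d: "set (take i as) \<inter> set (drop i (take j as)) = {}"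
    by (subst (asm) app) simp
  have s: "set (take j as) = set (take i as) \<union> set (drop i (take j as))"
    by (subst app) simp
  have "set (take j as) \<subseteq> W" "set (take j cs) \<inter> W = {}" "set (take i cs) \<subseteq> set (take j cs)"
    using sub disj set_take_subset_set_take[OF assms(1), of cs] by (auto dest: in_set_takeD)
  then have "exchange W as cs i - exchange W as cs j = set (drop i (take j as))"
    using d unfolding exchange_def s by auto
  moreover have "card (set (drop i (take j as))) = j - i"
    using distinct length assms by (simp add: distinct_card)
  ultimately show ?thesis by simp
qed

text \<open>Serves the half of the path that is traversed backwards, towards
  \<open>W\<close>.\<close>

lemma card_exchange_Diff':
  assumes "i \<le> j" and "j \<le> p"
  shows "card (exchange W as cs j - exchange W as cs i) = j - i"
  using card_exchange_Diff[OF assms] card_Diff_commute[OF finite_exchange finite_exchange]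
    fin card_exchange assms by (metis order_trans)

end

section \<open>An induced path through a given vertex\<close>

text \<open>Each half is a geodesic and so has no chords; \<open>far\<close> makes vertices of
  different halves distinct and non-adjacent. As \<open>W\<close> belongs to both halves,
  \<open>far\<close> can leave out the stages 0.\<close>

lemma exchange_in_monophonic_interval:
  assumes "exchange_lists W as cs p" and "exchange_lists W bs ds q"
    and W: "W \<in> verts (johnson_graph n r)" and "set cs \<subseteq> {1..n}" and "set ds \<subseteq> {1..n}"
    and far: "\<And>i j. 0 < i \<Longrightarrow> i \<le> p \<Longrightarrow> 0 < j \<Longrightarrow> j \<le> q \<Longrightarrow>
      2 \<le> card (exchange W as cs i - exchange W bs ds j)"
  shows "W \<in> monophonic_interval (johnson_graph n r) (exchange W as cs p) (exchange W bs ds q)"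
proof -
  let ?G = "johnson_graph n r"
  interpret P: exchange_lists W as cs p by fact
  interpret Q: exchange_lists W bs ds q by fact
  \<comment> \<open>Runs from stage \<open>p\<close> down to \<open>W\<close> at index
    \<open>p\<close>, then up the second sequence; at \<open>k = p\<close> both branches would give
    \<open>W\<close>.\<close>
  define f where "f k = (if k \<le> p then exchange W as cs (p - k) else exchange W bs ds (k - p))" for k
  have verts: "f k \<in> verts ?G" if "k \<le> p + q" for k
  proof -
    have "card (f k) = r"
      using that W P.card_exchange Q.card_exchange by (auto simp: f_def verts_johnson_graph)
    moreover have "f k \<subseteq> W \<union> set cs \<union> set ds"
      by (auto simp: f_def exchange_def dest: in_set_takeD)
    then have "f k \<subseteq> {1..n}"
      using W assms(4,5) by (auto simp: verts_johnson_graph)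
    ultimately show ?thesis by (simp add: verts_johnson_graph)
  qed
  have card: "card (f k - f l) = 1 \<longleftrightarrow> l = Suc k" "card (f k - f l) \<noteq> 0"
    if "k < l" "l \<le> p + q" for k l
  proof -
    \<comment> \<open>Index \<open>p\<close> falls into the first branch of \<open>f\<close>, so
      \<open>k = p\<close> is split off and read as stage 0 of the second sequence. Only the last
      case compares different halves.\<close>
    consider "l \<le> p" | "k = p" | "p < k" | "k < p" "p < l" by linarith
    then have "(card (f k - f l) = 1 \<longleftrightarrow> l = Suc k) \<and> card (f k - f l) \<noteq> 0"
    proof cases
      case 1
      then show ?thesis
        using that P.card_exchange_Diff'[of "p - l" "p - k"] by (auto simp: f_def)
    next
      case 2
      then show ?thesis
        using that Q.card_exchange_Diff[of 0 "l - p"] by (auto simp: f_def)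
    next
      case 3
      then show ?thesis
        using that Q.card_exchange_Diff[of "k - p" "l - p"] by (auto simp: f_def)
    next
      case 4
      then have "2 \<le> card (f k - f l)"
        using that by (auto simp: f_def intro!: far)
      moreover have "l \<noteq> Suc k" using 4 by linarith
      ultimately show ?thesis by linarith
    qed
    then show "card (f k - f l) = 1 \<longleftrightarrow> l = Suc k" "card (f k - f l) \<noteq> 0" by blast+
  qed
  have "induced_path ?G (f 0) (map f [0..<Suc (p + q)]) (f (p + q))"
  proof (rule induced_path_map_upt[OF sym_arcs_ends_johnson_graph irrefl_arcs_ends_johnson_graph])
    show "f k \<in> verts ?G" if "k \<le> p + q" for k by (rule verts[OF that])
    show "f k \<noteq> f l" if "k < l" "l \<le> p + q" for k l
      using card(2)[OF that] by auto
    show "(f k, f l) \<in> arcs_ends ?G \<longleftrightarrow> l = Suc k" if "k < l" "l \<le> p + q" for k l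
      using card(1)[OF that] verts[of k] verts[of l] that by (simp add: arcs_ends_johnson_graph)
  qed
  moreover have "f 0 = exchange W as cs p" by (simp add: f_def)
  \<comment> \<open>For \<open>q = 0\<close> the first branch of \<open>f\<close> applies; its value
    \<open>W\<close> is also stage 0 of the second sequence.\<close>
  moreover have "f (p + q) = exchange W bs ds q" by (cases q) (simp_all add: f_def)
  moreover have "f p = W" by (simp add: f_def)
  then have "W \<in> set (map f [0..<Suc (p + q)])"
    by (auto simp: image_iff intro!: bexI[of _ p] simp del: upt_Suc)
  ultimately show ?thesis unfolding monophonic_interval_def by auto
qed

section \<open>Choosing the first exchanges\<close>

text \<open>An element of \<open>X - Y\<close> inside \<open>W\<close> is never discarded towards
  \<open>X\<close>, and one outside \<open>W\<close> is never inserted towards \<open>Y\<close>.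
  Exchanged first, it separates all later stages. One element of each kind suffices; if there is
  only one kind, the second element acts from the second exchange on, and the first exchange needs a
  substitute.\<close>

lemma ex_far_exchange_lists:
  assumes far: "2 \<le> card (X - Y)" and XY: "finite X" "finite Y" "card X = card Y"
    and W: "finite W" "card W = card X" "W \<noteq> X" "W \<noteq> Y"
  obtains as bs cs ds where
    "distinct as" "set as = W - X" "distinct bs" "set bs = W - Y"
    "distinct cs" "set cs = X - W" "distinct ds" "set ds = Y - W"
    "\<And>i j. 0 < i \<Longrightarrow> 0 < j \<Longrightarrow> 2 \<le> card (exchange W as cs i - exchange W bs ds j)"
proof -
  note result = that and fin = XY(1,2) W(1)
  have AC: "card (W - X) = card (X - W)" and BD: "card (W - Y) = card (Y - W)"
    using card_Diff_commute fin XY W by metis+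
  \<comment> \<open>It suffices to choose prefixes of the four lists that give two witnesses under
    every continuation.\<close>
  have lists: thesis
    if prefixes: "set as0 \<subseteq> W - X" "set bs0 \<subseteq> W - Y" "set cs0 \<subseteq> X - W" "set ds0 \<subseteq> Y - W"
      "distinct as0" "distinct bs0" "distinct cs0" "distinct ds0"
      and ex: "\<And>i j as bs cs ds. 0 < i \<Longrightarrow> 0 < j \<Longrightarrow> set (as0 @ as) = W - X \<Longrightarrow>
        set (bs0 @ bs) = W - Y \<Longrightarrow> set (cs0 @ cs) = X - W \<Longrightarrow> set (ds0 @ ds) = Y - W \<Longrightarrow>
        \<exists>x y. x \<noteq> y \<and> {x, y} \<subseteq> exchange W (as0 @ as) (cs0 @ cs) i - exchange W (bs0 @ bs) (ds0 @ ds) j"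
    for as0 bs0 cs0 ds0
  proof -
    obtain as where as: "distinct (as0 @ as)" "set (as0 @ as) = W - X"
      by (rule ex_distinct_list_prefix[of "W - X" as0]) (use prefixes fin in auto)
    obtain bs where bs: "distinct (bs0 @ bs)" "set (bs0 @ bs) = W - Y"
      by (rule ex_distinct_list_prefix[of "W - Y" bs0]) (use prefixes fin in auto)
    obtain cs where cs: "distinct (cs0 @ cs)" "set (cs0 @ cs) = X - W"
      by (rule ex_distinct_list_prefix[of "X - W" cs0]) (use prefixes fin in auto)
    obtain ds where ds: "distinct (ds0 @ ds)" "set (ds0 @ ds) = Y - W"
      by (rule ex_distinct_list_prefix[of "Y - W" ds0]) (use prefixes fin in auto)
    have "2 \<le> card (exchange W (as0 @ as) (cs0 @ cs) i - exchange W (bs0 @ bs) (ds0 @ ds) j)"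
      if ij: "0 < i" "0 < j" for i j
    proof -
      obtain x y where "x \<noteq> y"
        "{x, y} \<subseteq> exchange W (as0 @ as) (cs0 @ cs) i - exchange W (bs0 @ bs) (ds0 @ ds) j"
        using ex[OF ij as(2) bs(2) cs(2) ds(2)] by blast
      then show ?thesis
        by (intro two_le_card[of _ x y] finite_Diff finite_exchange fin) auto
    qed
    with as bs cs ds show thesis by (rule result)
  qed
  obtain z1 z2 where z: "z1 \<in> X - Y" "z2 \<in> X - Y" "z1 \<noteq> z2"
    using far by (rule two_le_cardE)
  consider (mixed) b1 c1 where "b1 \<in> W" "b1 \<in> X - Y" "c1 \<notin> W" "c1 \<in> X - Y"
    | (kept) b1 b2 where "X - Y \<subseteq> W" "b1 \<in> X - Y" "b2 \<in> X - Y" "b1 \<noteq> b2"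
    | (new) c1 c2 where "(X - Y) \<inter> W = {}" "c1 \<in> X - Y" "c2 \<in> X - Y" "c1 \<noteq> c2"
    using z by blast
  then show thesis
  proof cases
    case mixed
    show ?thesis
    proof (rule lists[of "[]" "[b1]" "[c1]" "[]"])
      fix i j :: nat and as bs cs ds
      assume *: "0 < i" "0 < j" "set ([] @ as) = W - X" "set ([b1] @ bs) = W - Y"
        "set ([c1] @ cs) = X - W" "set ([] @ ds) = Y - W"
      let ?D = "exchange W ([] @ as) ([c1] @ cs) i - exchange W ([b1] @ bs) ([] @ ds) j"
      have "b1 \<in> ?D"
      proof (rule kept_in_exchange_Diff)
        show "b1 \<notin> set (take i ([] @ as))" by (rule notin_set_take) (use * mixed in blast)
        show "b1 \<in> set (take j ([b1] @ bs))" using * by (simp add: take_Cons')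
      qed (use * mixed in blast)+
      moreover have "c1 \<in> ?D"
      proof (rule new_in_exchange_Diff)
        show "c1 \<in> set (take i ([c1] @ cs))" using * by (simp add: take_Cons')
        show "c1 \<notin> set (take j ([] @ ds))" by (rule notin_set_take) (use * mixed in blast)
      qed (use mixed in blast)
      moreover have "b1 \<noteq> c1" using mixed by blast
      ultimately show "\<exists>x y. x \<noteq> y \<and> {x, y} \<subseteq> ?D" by blast
    qed (use mixed in auto)
  next
    case kept
    \<comment> \<open>The substitute \<open>c1\<close> lies in \<open>Y\<close> here, so it is
      eventually inserted towards \<open>Y\<close> too and works only temporarily.\<close>
    have "X - W \<noteq> {}"
      using W fin by (metis Diff_eq_empty_iff card_subset_eq)
    then obtain c1 where c1: "c1 \<in> X - W" by blast
    \<comment> \<open>At least two elements enter on the way to \<open>Y\<close>, so one of them,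
      \<open>d1\<close>, can go before \<open>c1\<close>.\<close>
    have "2 \<le> card (W - Y)" using kept fin by (intro two_le_card[of _ b1 b2]) auto
    then have "2 \<le> card (Y - W)" by (simp only: BD)
    then obtain d d' where "d \<in> Y - W" "d' \<in> Y - W" "d \<noteq> d'" by (rule two_le_cardE)
    then obtain d1 where d1: "d1 \<in> Y - W" "d1 \<noteq> c1" by blast
    show ?thesis
    proof (rule lists[of "[]" "[b1, b2]" "[c1]" "[d1]"])
      fix i j :: nat and as bs cs ds
      assume *: "0 < i" "0 < j" "set ([] @ as) = W - X" "set ([b1, b2] @ bs) = W - Y"
        "set ([c1] @ cs) = X - W" "set ([d1] @ ds) = Y - W"
      let ?D = "exchange W ([] @ as) ([c1] @ cs) i - exchange W ([b1, b2] @ bs) ([d1] @ ds) j"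
      show "\<exists>x y. x \<noteq> y \<and> {x, y} \<subseteq> ?D"
      \<comment> \<open>At \<open>j = 1\<close> only \<open>d1\<close> has entered towards
        \<open>Y\<close>, and \<open>c1\<close> stands in for \<open>b2\<close>; afterwards
        \<open>b2\<close> has been discarded as well.\<close>
      proof (cases "j = 1")
        case True
        have "b1 \<in> ?D"
        proof (rule kept_in_exchange_Diff)
          show "b1 \<notin> set (take i ([] @ as))" by (rule notin_set_take) (use * kept in blast)
          show "b1 \<in> set (take j ([b1, b2] @ bs))" using * by (simp add: take_Cons')
        qed (use * kept in blast)+
        moreover have "c1 \<in> ?D"
        proof (rule new_in_exchange_Diff)
          show "c1 \<in> set (take i ([c1] @ cs))" using * by (simp add: take_Cons')
          show "c1 \<notin> set (take j ([d1] @ ds))" using True d1 by simp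
        qed (use c1 in blast)
        moreover have "b1 \<noteq> c1" using kept c1 by blast
        ultimately show ?thesis by blast
      next
        case False
        have "b1 \<in> ?D"
        proof (rule kept_in_exchange_Diff)
          show "b1 \<notin> set (take i ([] @ as))" by (rule notin_set_take) (use * kept in blast)
          show "b1 \<in> set (take j ([b1, b2] @ bs))" using * by (simp add: take_Cons')
        qed (use * kept in blast)+
        moreover have "b2 \<in> ?D"
        proof (rule kept_in_exchange_Diff)
          show "b2 \<notin> set (take i ([] @ as))" by (rule notin_set_take) (use * kept in blast)
          show "b2 \<in> set (take j ([b1, b2] @ bs))" using * False by (simp add: take_Cons')
        qed (use * kept in blast)+
        ultimately show ?thesis using kept by blast
      qed
    qed (use kept c1 d1 in auto)
  next
    case new
    \<comment> \<open>Mirror image of the previous case: the substitute \<open>b1\<close> is not in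
      \<open>X\<close>, so it is eventually discarded towards \<open>X\<close>; discarding
      \<open>a1\<close> first preserves it through stage 1.\<close>
    have "W - Y \<noteq> {}"
      using W XY by (metis Diff_eq_empty_iff card_subset_eq)
    then obtain b1 where b1: "b1 \<in> W - Y" by blast
    have "2 \<le> card (X - W)" using new fin by (intro two_le_card[of _ c1 c2]) auto
    then have "2 \<le> card (W - X)" by (simp only: AC)
    then obtain a a' where "a \<in> W - X" "a' \<in> W - X" "a \<noteq> a'" by (rule two_le_cardE)
    then obtain a1 where a1: "a1 \<in> W - X" "a1 \<noteq> b1" by blast
    show ?thesis
    proof (rule lists[of "[a1]" "[b1]" "[c1, c2]" "[]"])
      fix i j :: nat and as bs cs ds
      assume *: "0 < i" "0 < j" "set ([a1] @ as) = W - X" "set ([b1] @ bs) = W - Y"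
        "set ([c1, c2] @ cs) = X - W" "set ([] @ ds) = Y - W"
      let ?D = "exchange W ([a1] @ as) ([c1, c2] @ cs) i - exchange W ([b1] @ bs) ([] @ ds) j"
      show "\<exists>x y. x \<noteq> y \<and> {x, y} \<subseteq> ?D"
      proof (cases "i = 1")
        case True
        have "b1 \<in> ?D"
        proof (rule kept_in_exchange_Diff)
          show "b1 \<notin> set (take i ([a1] @ as))" using True a1 by simp
          show "b1 \<in> set (take j ([b1] @ bs))" using * by (simp add: take_Cons')
        qed (use * b1 in blast)+
        moreover have "c1 \<in> ?D"
        proof (rule new_in_exchange_Diff)
          show "c1 \<in> set (take i ([c1, c2] @ cs))" using * by (simp add: take_Cons')
          show "c1 \<notin> set (take j ([] @ ds))" by (rule notin_set_take) (use * new in blast)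
        qed (use new in blast)
        moreover have "b1 \<noteq> c1" using new b1 by blast
        ultimately show ?thesis by blast
      next
        case False
        have "c1 \<in> ?D"
        proof (rule new_in_exchange_Diff)
          show "c1 \<in> set (take i ([c1, c2] @ cs))" using * by (simp add: take_Cons')
          show "c1 \<notin> set (take j ([] @ ds))" by (rule notin_set_take) (use * new in blast)
        qed (use new in blast)
        moreover have "c2 \<in> ?D"
        proof (rule new_in_exchange_Diff)
          show "c2 \<in> set (take i ([c1, c2] @ cs))" using * False by (simp add: take_Cons')
          show "c2 \<notin> set (take j ([] @ ds))" by (rule notin_set_take) (use * new in blast)
        qed (use new in blast)
        ultimately show ?thesis using new by blast
      qed
    qed (use new b1 a1 in auto)
  qed
qed

section \<open>Monophonic pairs and the monophonic number\<close>

text \<open>For distinct non-adjacent vertices \<open>card (X - Y)\<close> is neither 0 nor 1, hence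
  at least 2, as the choice of exchanges requires.\<close>

lemma monophonic_set_johnson_graph:
  assumes X: "X \<in> verts (johnson_graph n r)" and Y: "Y \<in> verts (johnson_graph n r)"
    and "X \<noteq> Y" and "(X, Y) \<notin> arcs_ends (johnson_graph n r)"
  shows "monophonic_set (johnson_graph n r) {X, Y}"
proof -
  let ?G = "johnson_graph n r"
  have vert: "finite A" "card A = r" "A \<subseteq> {1..n}" if "A \<in> verts ?G" for A
    using that finite_subset[of A "{1..n}"] by (auto simp: verts_johnson_graph)
  have "card (X - Y) \<noteq> 1" using assms by (auto simp: arcs_ends_johnson_graph)
  moreover have "card (X - Y) \<noteq> 0"
    using \<open>X \<noteq> Y\<close> vert[OF X] vert[OF Y] by (auto dest: card_subset_eq)
  ultimately have far: "2 \<le> card (X - Y)" by linarith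
  have "W \<in> monophonic_interval ?G X Y" if W: "W \<in> verts ?G" for W
  proof (cases "W = X \<or> W = Y")
    case True
    then show ?thesis by (auto simp: monophonic_interval_def)
  next
    case False
    then obtain as bs cs ds where
      1: "distinct as" "set as = W - X" "distinct bs" "set bs = W - Y"
        "distinct cs" "set cs = X - W" "distinct ds" "set ds = Y - W"
      and 2: "\<And>i j. 0 < i \<Longrightarrow> 0 < j \<Longrightarrow> 2 \<le> card (exchange W as cs i - exchange W bs ds j)"
      using ex_far_exchange_lists[OF far] vert[OF X] vert[OF Y] vert[OF W] by metis
    have len: "length as = length cs" "length bs = length ds"
      using 1 vert[OF X] vert[OF Y] vert[OF W] card_Diff_commute
      by (metis distinct_card)+
    have lists: "exchange_lists W as cs (length cs)" "exchange_lists W bs ds (length ds)"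
      using 1 len vert[OF W] by (unfold_locales, auto)+
    moreover have "set cs \<subseteq> {1..n}" "set ds \<subseteq> {1..n}"
      using 1 vert[OF X] vert[OF Y] by auto
    ultimately have "W \<in> monophonic_interval ?G (exchange W as cs (length cs)) (exchange W bs ds (length ds))"
      using W 2 by (intro exchange_in_monophonic_interval) auto
    moreover have "exchange W as cs (length cs) = X" "exchange W bs ds (length ds) = Y"
      using 1 len by (simp_all add: exchange_full)
    ultimately show ?thesis by simp
  qed
  then show ?thesis using X Y by (auto simp: monophonic_set_def)
qed

text \<open>Vertices on a path do not repeat, so a path that ends where it starts is
  trivial.\<close>

lemma monophonic_interval_same: "monophonic_interval G u u = {u}"
proof -
  have "set p = {u}" if "induced_path G u p u" for p
  proof -
    from that have p: "p \<noteq> []" "distinct p" "hd p = u" "last p = u"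
      by (auto simp: induced_path_def vpath_def vwalk_def)
    then have "p = [u]" by (cases p) (auto split: if_splits)
    then show ?thesis by simp
  qed
  then show ?thesis by (auto simp: monophonic_interval_def)
qed

lemma two_le_card_monophonic_set:
  assumes "monophonic_set G S" and "finite S" and "x \<in> verts G" and "y \<in> verts G" and "x \<noteq> y"
  shows "2 \<le> card S"
proof (rule ccontr)
  assume "\<not> 2 \<le> card S"
  then have "card S = 0 \<or> card S = 1" by linarith
  with \<open>finite S\<close> consider "S = {}" | u where "S = {u}" by (auto simp: card_1_singleton_iff)
  then show False
    using assms by cases (auto simp: monophonic_set_def monophonic_interval_same)
qed

theorem theorem3p13:
  fixes n r :: nat
  assumes "2 \<le> r" and "r + 2 \<le> n"
  shows "strongly_two_monophonic (johnson_graph n r)"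
proof -
  \<comment> \<open>The shift by two gives \<open>?X - ?Y = {1, 2}\<close>, hence a non-adjacent
    pair; \<open>2 \<le> r\<close> puts 2 into \<open>?X\<close>, and \<open>r + 2 \<le> n\<close>
    keeps \<open>?Y\<close> inside \<open>{1..n}\<close>.\<close>
  let ?G = "johnson_graph n r" and ?X = "{1..r}" and ?Y = "{3..r + 2}"
  have XY: "?X \<in> verts ?G" "?Y \<in> verts ?G"
    using assms by (auto simp: verts_johnson_graph)
  have "?X - ?Y = {1, 2}" using assms by auto
  then have card: "card (?X - ?Y) = 2" by simp
  then have "?X \<noteq> ?Y" by (metis Diff_cancel card.empty zero_neq_numeral)
  moreover from card have "(?X, ?Y) \<notin> arcs_ends ?G" by (simp add: arcs_ends_johnson_graph)
  ultimately have "monophonic_set ?G {?X, ?Y}" "card {?X, ?Y} = 2"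
    using monophonic_set_johnson_graph XY by auto
  then have "monophonic_number ?G = 2"
    unfolding monophonic_number_def
    using two_le_card_monophonic_set[OF _ _ XY \<open>?X \<noteq> ?Y\<close>]
    by (intro Least_equality) (auto intro!: exI[of _ "{?X, ?Y}"])
  then show ?thesis
    unfolding strongly_two_monophonic_def two_monophonic_def
    using monophonic_set_johnson_graph by blast
qed

end
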